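(* Let $\mathcal{G}$ be the set of isomorphism classes of weakly labeled graphs $(G,\ell)$ and let $\mathcal{H}$ be the class of collections of non-trivial harmonic subsets of $\mathbb{Z}$, of uniformly bounded cardinality, satisfying (P1)–(P5) (all defined in the context). Then the maps $$\mathcal{G}\to\mathcal{H},\ (G,\ell)\mapsto \mathcal{A}_{(G,\ell)}\qquad\text{and}\qquad \mathcal{H}\to\mathcal{G},\ \mathcal{A}\mapsto (G_{\mathcal{A}},\ell_{\mathcal{A}})$$ are mutually inverse.
   Context: Graphs are simple, connected, of bounded degree, with at least three vertices (finite or infinite). $V_G$ is the vertex set, $v\sim w$ means adjacency, $S_G$ is the set of leaves (vertices of degree one), and $N_G(v)=\{v\}\cup\{w: w\sim v\}$ is the closed neighborhood. An integer interval is a nonempty (finite or infinite) set of consecutive integers. A weak harmonic labeling of $G$ onto an integer interval $I$ is a bijection $\ell:V_G\to I$ with $\ell(v)=\frac{1}{\deg(v)}\sum_{w\sim v}\ell(w)$ for every $v\in V_G\setminus S_G$. A weakly labeled graph is a pair $(G,\ell)$ with $\ell$ a weak harmonic labeling of $G$ onto some integer interval. An isomorphism $(G,\ell)\to(G',\ell')$ is a graph isomorphism $f:G\to G'$ with $\ell'(f(v))=\ell(v)$ for all $v\in V_G$. $\mathcal{G}$ is the set of weakly labeled graphs modulo isomorphism. For a nonempty finite $A\subset\mathbb{Z}$ let $av(A)=\frac{1}{|A|}\sum_{k\in A}k$. $A$ is a harmonic subset of $\mathbb{Z}$ if $av(A)\in A$; it is trivial if $|A|=1$. For $(G,\ell)\in\mathcal{G}$,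 $\mathcal{A}_{(G,\ell)}=\{A_v: v\in V_G\setminus S_G\}$ where $A_v=\{\ell(w): w\in N_G(v)\}$. $\mathcal{H}$ is the class of collections $\mathcal{A}$ of non-trivial harmonic subsets of $\mathbb{Z}$ with $\sup_{A\in\mathcal{A}}|A|<\infty$ such that, for all $A,B\in\mathcal{A}$: (P1) $\bigcup_{C\in\mathcal{A}}C$ is an integer interval; (P2) $av(A)\neq av(B)$ if $A\neq B$; (P3) if $t\in A\cap B$ and $A\neq B$, then there exists $C\in\mathcal{A}$ with $av(C)=t$; (P4) if $av(A)\in B$ then $av(B)\in A$; (P5) there is a finite sequence $A_{i_1},\ldots,A_{i_r}$ in $\mathcal{A}$ with $A_{i_1}=A$, $A_{i_r}=B$ and $av(A_{i_j})\in A_{i_{j+1}}$ for $1\le j\le r-1$. For $\mathcal{A}\in\mathcal{H}$ with $I=\bigcup_{C\in\mathcal{A}}C$, $G_{\mathcal{A}}$ is the simple graph with vertex set $I$ in which distinct $i,j\in I$ are adjacent iff there is $A\in\mathcal{A}$ with ($i=av(A)$ and $j\in A$) or ($j=av(A)$ and $i\in A$); and $\ell_{\mathcal{A}}:I\to I$ is $\ell_{\mathcal{A}}(i)=i$. *)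

theory Defs
  imports Complex_Main "Graph_Theory.Digraph_Component"
begin

text \<open>
  A simple graph, possibly infinite, is a \<^locale>\<open>pair_bidirected_digraph\<close>: a loopless digraph
  without parallel arcs whose arc set is symmetric, so that an edge \<open>v \<sim> w\<close> is the pair of arcs
  \<open>(v, w)\<close> and \<open>(w, v)\<close>, and the degree of a vertex is its out-degree.
\<close>

definition neighbors :: "'v pair_pre_digraph \<Rightarrow> 'v \<Rightarrow> 'v set" where
  "neighbors G v = {w. (v, w) \<in> parcs G}"

abbreviation closed_neighborhood :: "'v pair_pre_digraph \<Rightarrow> 'v \<Rightarrow> 'v set" where
  "closed_neighborhood G v \<equiv> insert v (neighbors G v)"

abbreviation degree :: "'v pair_pre_digraph \<Rightarrow> 'v \<Rightarrow> nat" where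
  "degree G v \<equiv> out_degree (with_proj G) v"

definition leaves :: "'v pair_pre_digraph \<Rightarrow> 'v set" where
  "leaves G = {v \<in> pverts G. degree G v = 1}"

text \<open>
  Finiteness of the neighborhoods is required separately because \<^const>\<open>out_degree\<close> is \<open>0\<close>
  at a vertex with infinitely many neighbors.
\<close>

definition admissible_graph :: "'v pair_pre_digraph \<Rightarrow> bool" where
  "admissible_graph G \<longleftrightarrow>
     pair_bidirected_digraph G \<and>
     Digraph_Component.connected (with_proj G) \<and>
     (\<forall>v\<in>pverts G. finite (neighbors G v)) \<and> bdd_above (degree G ` pverts G) \<and>
     (finite (pverts G) \<longrightarrow> 3 \<le> card (pverts G))"

definition integer_interval :: "int set \<Rightarrow> bool" where
  "integer_interval I \<longleftrightarrow> I \<noteq> {} \<and> (\<forall>a\<in>I. \<forall>b\<in>I. {a..b} \<subseteq> I)"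

definition weak_harmonic_labeling ::
    "'v pair_pre_digraph \<Rightarrow> ('v \<Rightarrow> int) \<Rightarrow> int set \<Rightarrow> bool" where
  "weak_harmonic_labeling G l I \<longleftrightarrow>
     bij_betw l (pverts G) I \<and>
     (\<forall>v\<in>pverts G - leaves G.
        rat_of_int (l v) = (\<Sum>w\<in>neighbors G v. rat_of_int (l w)) / rat_of_nat (degree G v))"

text \<open>
  Only the values of the labeling on the vertex set matter; its values elsewhere are disregarded
  by the isomorphisms below.
\<close>

type_synonym 'v labeled_graph = "'v pair_pre_digraph \<times> ('v \<Rightarrow> int)"

definition weakly_labeled_graphs :: "'v labeled_graph set" where
  "weakly_labeled_graphs =
     {(G, l). admissible_graph G \<and> (\<exists>I. integer_interval I \<and> weak_harmonic_labeling G l I)}"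

fun isomorphic :: "'v labeled_graph \<Rightarrow> 'w labeled_graph \<Rightarrow> bool" where
  "isomorphic (G, l) (G', l') \<longleftrightarrow>
     (\<exists>f. bij_betw f (pverts G) (pverts G') \<and>
          (\<forall>v\<in>pverts G. \<forall>w\<in>pverts G. (v, w) \<in> parcs G \<longleftrightarrow> (f v, f w) \<in> parcs G') \<and>
          (\<forall>v\<in>pverts G. l' (f v) = l v))"

definition iso_rel :: "'v labeled_graph rel" where
  "iso_rel = {(x, y). x \<in> weakly_labeled_graphs \<and> y \<in> weakly_labeled_graphs \<and> isomorphic x y}"

text \<open>
  The set \<open>\<G>\<close>, for vertices drawn from the type \<^typ>\<open>'v\<close>. All weakly labeled graphs are countable,
  so every infinite \<^typ>\<open>'v\<close> yields a copy of each of them.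
\<close>

definition iso_classes :: "'v labeled_graph set set" where
  "iso_classes = weakly_labeled_graphs // iso_rel"

definition av :: "int set \<Rightarrow> rat" where
  "av A = (\<Sum>k\<in>A. rat_of_int k) / rat_of_nat (card A)"

definition harmonic_subset :: "int set \<Rightarrow> bool" where
  "harmonic_subset A \<longleftrightarrow> finite A \<and> A \<noteq> {} \<and> av A \<in> rat_of_int ` A"

definition harmonic_collections :: "int set set set" where
  "harmonic_collections = {\<A>.
     (\<forall>A\<in>\<A>. harmonic_subset A \<and> card A \<noteq> 1) \<and>
     bdd_above (card ` \<A>) \<and>
     integer_interval (\<Union>\<A>) \<and>
     (\<forall>A\<in>\<A>. \<forall>B\<in>\<A>. A \<noteq> B \<longrightarrow> av A \<noteq> av B) \<and>
     (\<forall>A\<in>\<A>. \<forall>B\<in>\<A>. \<forall>t. t \<in> A \<inter> B \<and> A \<noteq> B \<longrightarrow> (\<exists>C\<in>\<A>. av C = rat_of_int t)) \<and>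
     (\<forall>A\<in>\<A>. \<forall>B\<in>\<A>. av A \<in> rat_of_int ` B \<longrightarrow> av B \<in> rat_of_int ` A) \<and>
     (\<forall>A\<in>\<A>. \<forall>B\<in>\<A>. \<exists>As. As \<noteq> [] \<and> set As \<subseteq> \<A> \<and> hd As = A \<and> last As = B \<and>
        (\<forall>j. Suc j < length As \<longrightarrow> av (As ! j) \<in> rat_of_int ` (As ! Suc j)))}"

fun collection_of :: "'v labeled_graph \<Rightarrow> int set set" where
  "collection_of (G, l) = {l ` closed_neighborhood G v | v. v \<in> pverts G - leaves G}"

definition graph_of :: "int set set \<Rightarrow> int pair_pre_digraph" where
  "graph_of \<A> = \<lparr> pverts = \<Union>\<A>,
     parcs = {(i, j). i \<in> \<Union>\<A> \<and> j \<in> \<Union>\<A> \<and> i \<noteq> j \<and>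
       (\<exists>A\<in>\<A>. rat_of_int i = av A \<and> j \<in> A \<or> rat_of_int j = av A \<and> i \<in> A)} \<rparr>"

definition labeled_graph_of :: "int set set \<Rightarrow> int labeled_graph" where
  "labeled_graph_of \<A> = (graph_of \<A>, \<lambda>i. i)"

text \<open>
  The two maps between \<open>\<G>\<close> and \<open>\<H>\<close>. The first is meaningful because \<^const>\<open>collection_of\<close> is
  constant on each isomorphism class, so that its image of a class is a singleton. The second sends
  \<open>\<A>\<close> to the isomorphism class of \<open>(G\<^sub>\<A>, \<ell>\<^sub>\<A>)\<close>, realized on vertices of type \<^typ>\<open>'v\<close>; for
  \<^typ>\<open>int\<close> this is the class containing \<open>(G\<^sub>\<A>, \<ell>\<^sub>\<A>)\<close> itself.
\<close>

definition to_collection :: "'v labeled_graph set \<Rightarrow> int set set" where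
  "to_collection X = the_elem (collection_of ` X)"

definition to_iso_class :: "int set set \<Rightarrow> 'v labeled_graph set" where
  "to_iso_class \<A> = {x \<in> weakly_labeled_graphs. isomorphic (labeled_graph_of \<A>) x}"

end

theory Submission
  imports Defs
begin

text \<open>
  A weak labeling is injective, so a vertex is determined by its label and a labeled graph may be
  thought of as a graph on an integer interval. Harmonicity at a non-leaf \<open>v\<close> says that \<open>\<ell>(v)\<close> is
  the average of the labels of its neighbors; adding the average itself to a set of numbers does not
  change the average, so this is the same as saying that \<open>\<ell>(v)\<close> is the average of
  \<open>A\<^sub>v = \<ell>(N\<^sub>G(v))\<close> (\<open>av_insert_eq_iff\<close>). Hence \<open>A\<^sub>v\<close> is a harmonic set that remembers its centre \<open>v\<close>,
  and all edges at \<open>v\<close>. Every edge of a connected graph with at least three vertices has an end that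
  is not a leaf, so the sets \<open>A\<^sub>v\<close> contain all the information about the graph
  (\<open>isomorphic_graph_of_collection\<close>).

  In the other direction, a collection \<open>\<A> \<in> \<H>\<close> yields a graph in which the centre of \<open>A \<in> \<A>\<close> has
  precisely the neighbors \<open>A - {av A}\<close>: further neighbors could only come from another set centred
  at the same point, which (P2) excludes, or from the point lying in a set centred elsewhere, and
  then (P4) puts that other centre into \<open>A\<close>. A point that is not a centre lies in only one set, by
  (P3), and so is a leaf. Thus the non-leaves of \<open>G\<^sub>\<A>\<close> are the centres, and their closed
  neighborhoods are the members of \<open>\<A>\<close> (\<open>collection_of_labeled_graph_of\<close>). The conditions (P1) and
  (P5) correspond to the labels filling an interval and to connectedness: deleting the leaves of a
  connected graph leaves it connected, so any two non-leaves are joined by a path of non-leaves.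

  The remaining work is to pass to isomorphism classes: all the data are preserved by isomorphism,
  and a graph on integers can be copied to any infinite type of vertices.
\<close>

section \<open>Elementary form of the graph conditions\<close>

lemma degree_eq_card_neighbors: "degree G v = card (neighbors G v)"
proof -
  have "out_arcs (with_proj G) v = Pair v ` neighbors G v"
    by (auto simp: neighbors_def)
  then show ?thesis
    by (simp add: out_degree_def card_image inj_on_def)
qed

lemma pair_bidirected_digraph_iff:
  "pair_bidirected_digraph G \<longleftrightarrow>
     parcs G \<subseteq> pverts G \<times> pverts G \<and> sym (parcs G) \<and> irrefl (parcs G)"
proof
  assume "pair_bidirected_digraph G"
  then interpret pair_bidirected_digraph G .
  show "parcs G \<subseteq> pverts G \<times> pverts G \<and> sym (parcs G) \<and> irrefl (parcs G)"
    using arc_fst_in_verts arc_snd_in_verts pair_no_loops arcs_symmetric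
    by (fastforce simp: sym_def irrefl_def)
next
  assume "parcs G \<subseteq> pverts G \<times> pverts G \<and> sym (parcs G) \<and> irrefl (parcs G)"
  then show "pair_bidirected_digraph G"
    by unfold_locales (auto simp: symmetric_def irrefl_def)
qed

text \<open>
  Connectedness is used throughout in the form that no proper nonempty set of vertices is closed
  under adjacency; this avoids walks and is visibly invariant under isomorphism.
\<close>

lemma connected_iff_no_closed_set:
  assumes "pair_bidirected_digraph G"
  shows "Digraph_Component.connected (with_proj G) \<longleftrightarrow>
    pverts G \<noteq> {} \<and>
    (\<forall>S\<subseteq>pverts G. S \<noteq> {} \<and> (\<forall>v\<in>S. neighbors G v \<subseteq> S) \<longrightarrow> S = pverts G)"
proof -
  interpret pair_bidirected_digraph G by fact
  have sc: "Digraph_Component.connected (with_proj G) \<longleftrightarrow>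
      pverts G \<noteq> {} \<and> (\<forall>u\<in>pverts G. \<forall>v\<in>pverts G. u \<rightarrow>\<^sup>*\<^bsub>with_proj G\<^esub> v)"
    using reachable_mk_symmetric_eq[OF pair_sym_arcs]
    by (simp add: connected_def strongly_connected_def)
  have "S = pverts G"
    if reach: "\<forall>u\<in>pverts G. \<forall>v\<in>pverts G. u \<rightarrow>\<^sup>*\<^bsub>with_proj G\<^esub> v"
      and S: "S \<subseteq> pverts G" "S \<noteq> {}" "\<forall>v\<in>S. neighbors G v \<subseteq> S" for S
  proof -
    obtain u where u: "u \<in> S" using S by auto
    have "v \<in> S" if "u \<rightarrow>\<^sup>*\<^bsub>with_proj G\<^esub> v" for v
      using that
    proof (induction rule: reachable_induct)
      case base show ?case by (rule u)
    next
      case (step x y) then show ?case using S(3) by (auto simp: neighbors_def)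
    qed
    then show ?thesis using reach S(1) u by blast
  qed
  moreover have "u \<rightarrow>\<^sup>*\<^bsub>with_proj G\<^esub> v"
    if closed: "\<forall>S\<subseteq>pverts G. S \<noteq> {} \<and> (\<forall>v\<in>S. neighbors G v \<subseteq> S) \<longrightarrow> S = pverts G"
      and uv: "u \<in> pverts G" "v \<in> pverts G" for u v
  proof -
    let ?S = "{w. u \<rightarrow>\<^sup>*\<^bsub>with_proj G\<^esub> w}"
    have "?S \<subseteq> pverts G" by (auto elim: reachable_in_vertsE)
    moreover have "u \<in> ?S" using uv by simp
    moreover have "\<forall>w\<in>?S. neighbors G w \<subseteq> ?S"
      by (auto simp: neighbors_def intro: reachable_adj_trans)
    ultimately have "?S = pverts G" using closed by blast
    then show ?thesis using uv by auto
  qed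
  ultimately show ?thesis unfolding sc by blast
qed

lemma admissible_graph_iff:
  "admissible_graph G \<longleftrightarrow>
     parcs G \<subseteq> pverts G \<times> pverts G \<and> sym (parcs G) \<and> irrefl (parcs G) \<and>
     pverts G \<noteq> {} \<and>
     (\<forall>S\<subseteq>pverts G. S \<noteq> {} \<and> (\<forall>v\<in>S. neighbors G v \<subseteq> S) \<longrightarrow> S = pverts G) \<and>
     (\<forall>v\<in>pverts G. finite (neighbors G v)) \<and>
     bdd_above ((\<lambda>v. card (neighbors G v)) ` pverts G) \<and>
     (finite (pverts G) \<longrightarrow> 3 \<le> card (pverts G))"
proof (cases "pair_bidirected_digraph G")
  case True
  then show ?thesis
    unfolding admissible_graph_def degree_eq_card_neighbors connected_iff_no_closed_set[OF True]
    by (simp only: pair_bidirected_digraph_iff simp_thms conj_assoc)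
next
  case False
  then have "\<not> (parcs G \<subseteq> pverts G \<times> pverts G \<and> sym (parcs G) \<and> irrefl (parcs G))"
    by (simp only: pair_bidirected_digraph_iff not_False_eq_True)
  then show ?thesis using False unfolding admissible_graph_def by argo
qed

lemma in_leaves_iff: "v \<in> leaves G \<longleftrightarrow> v \<in> pverts G \<and> card (neighbors G v) = 1"
  by (simp add: leaves_def degree_eq_card_neighbors)

section \<open>Harmonic sets and chains\<close>

text \<open>
  Adjoining \<open>c\<close> to \<open>N\<close> raises the sum by \<open>c\<close> and the number of elements by one, so \<open>c\<close> is the
  average before exactly if it is the average afterwards.
\<close>

lemma av_insert_eq_iff:
  assumes "finite N" "N \<noteq> {}" "c \<notin> N"
  shows "av (insert c N) = rat_of_int c \<longleftrightarrow>
    rat_of_int c = (\<Sum>k\<in>N. rat_of_int k) / rat_of_nat (card N)"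
proof -
  have "rat_of_nat (card N) > 0" using assms by (simp add: card_gt_0_iff)
  then show ?thesis using assms
    by (simp add: av_def field_simps) (auto simp: field_simps)
qed

text \<open>
  The average of two distinct numbers is neither of them. This is what makes every centre of a
  non-trivial harmonic set a vertex of degree at least two, hence not a leaf.
\<close>

lemma harmonic_subset_card_ge_3:
  assumes A: "harmonic_subset A" and "card A \<noteq> 1"
  shows "3 \<le> card A"
proof -
  obtain c where c: "c \<in> A" "av A = rat_of_int c"
    using A by (auto simp: harmonic_subset_def)
  have fin: "finite A" using A by (simp add: harmonic_subset_def)
  let ?N = "A - {c}"
  have A_eq: "A = insert c ?N" using c(1) by (simp add: insert_absorb)
  have card_A: "card A = Suc (card ?N)" by (rule card.remove[OF fin c(1)])
  have "card ?N \<noteq> 1"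
  proof
    assume one: "card ?N = 1"
    then obtain d where d: "?N = {d}" by (rule card_1_singletonE)
    have "A = {c, d}" using A_eq unfolding d .
    moreover have "c \<noteq> d" using d by blast
    ultimately show False using av_insert_eq_iff[of "{d}" c] c(2) by simp
  qed
  then show ?thesis using card_A assms(2) by linarith
qed

text \<open>
  Condition (P5) asks for lists; the reflexive transitive closure carries the induction principle
  needed to use and to establish it.
\<close>

lemma chain_iff_rtrancl:
  "(\<exists>xs. xs \<noteq> [] \<and> set xs \<subseteq> X \<and> hd xs = a \<and> last xs = b \<and>
      (\<forall>j. Suc j < length xs \<longrightarrow> r (xs ! j) (xs ! Suc j))) \<longleftrightarrow>
   a \<in> X \<and> (a, b) \<in> {(x, y). x \<in> X \<and> y \<in> X \<and> r x y}\<^sup>*"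
  (is "?chain a b \<longleftrightarrow> _ \<and> (a, b) \<in> ?R\<^sup>*")
proof
  have "hd xs \<in> X \<and> (hd xs, last xs) \<in> ?R\<^sup>*"
    if "xs \<noteq> []" "set xs \<subseteq> X" "successively r xs" for xs
    using that
  proof (induction xs rule: induct_list012)
    case (3 x y zs)
    then have "(x, y) \<in> ?R" "(y, last (y # zs)) \<in> ?R\<^sup>*" by auto
    then show ?case using 3 by (auto intro: converse_rtrancl_into_rtrancl)
  qed auto
  then show "a \<in> X \<and> (a, b) \<in> ?R\<^sup>*" if "?chain a b"
    using that by (fastforce simp: successively_conv_nth)
next
  assume "a \<in> X \<and> (a, b) \<in> ?R\<^sup>*"
  then have a: "a \<in> X" and "(a, b) \<in> ?R\<^sup>*" by auto
  from this(2) have "\<exists>xs. xs \<noteq> [] \<and> set xs \<subseteq> X \<and> hd xs = a \<and> last xs = b \<and> successively r xs"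
  proof (induction rule: rtrancl_induct)
    case base
    show ?case using a by (intro exI[of _ "[a]"]) auto
  next
    case (step y z)
    then obtain xs where "xs \<noteq> []" "set xs \<subseteq> X" "hd xs = a" "last xs = y" "successively r xs"
      by auto
    then show ?case using step(2)
      by (intro exI[of _ "xs @ [z]"]) (auto simp: successively_append_iff)
  qed
  then show "?chain a b" by (auto simp: successively_conv_nth)
qed

lemmas linked_iff_rtrancl =
  chain_iff_rtrancl[where r = "\<lambda>A B. av A \<in> rat_of_int ` B"]

section \<open>Invariance under isomorphism\<close>

lemma isomorphic_refl: "isomorphic x x"
proof (cases x)
  case (Pair G l)
  then show ?thesis by (auto intro!: exI[of _ id])
qed

lemma isomorphic_sym:
  assumes "isomorphic x y"
  shows "isomorphic y x"
proof -
  obtain G l G' l' where xy: "x = (G, l)" "y = (G', l')" by fastforce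
  obtain f where bij: "bij_betw f (pverts G) (pverts G')"
    and arc: "\<And>v w. v \<in> pverts G \<Longrightarrow> w \<in> pverts G \<Longrightarrow> (v, w) \<in> parcs G \<longleftrightarrow> (f v, f w) \<in> parcs G'"
    and lab: "\<And>v. v \<in> pverts G \<Longrightarrow> l' (f v) = l v"
    using assms xy by auto
  let ?g = "inv_into (pverts G) f"
  have g: "?g v \<in> pverts G" "f (?g v) = v" if "v \<in> pverts G'" for v
    using that bij by (auto simp: bij_betw_def inv_into_into f_inv_into_f)
  have "bij_betw ?g (pverts G') (pverts G)" using bij by (rule bij_betw_inv_into)
  moreover have "(v, w) \<in> parcs G' \<longleftrightarrow> (?g v, ?g w) \<in> parcs G"
    if "v \<in> pverts G'" "w \<in> pverts G'" for v w
    using that arc[of "?g v" "?g w"] g by simp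
  moreover have "l (?g v) = l' v" if "v \<in> pverts G'" for v
    using that lab[of "?g v"] g by simp
  ultimately show ?thesis unfolding xy isomorphic.simps by blast
qed

lemma isomorphic_trans:
  assumes "isomorphic x y" "isomorphic y z"
  shows "isomorphic x z"
proof -
  obtain G l G' l' G'' l'' where xyz: "x = (G, l)" "y = (G', l')" "z = (G'', l'')"
    by (metis surj_pair)
  obtain f where f: "bij_betw f (pverts G) (pverts G')"
    "\<forall>v\<in>pverts G. \<forall>w\<in>pverts G. (v, w) \<in> parcs G \<longleftrightarrow> (f v, f w) \<in> parcs G'"
    "\<forall>v\<in>pverts G. l' (f v) = l v"
    using assms(1) xyz by auto
  obtain g where g: "bij_betw g (pverts G') (pverts G'')"
    "\<forall>v\<in>pverts G'. \<forall>w\<in>pverts G'. (v, w) \<in> parcs G' \<longleftrightarrow> (g v, g w) \<in> parcs G''"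
    "\<forall>v\<in>pverts G'. l'' (g v) = l' v"
    using assms(2) xyz by auto
  have fV: "f v \<in> pverts G'" if "v \<in> pverts G" for v
    using that f(1) by (auto simp: bij_betw_def)
  have "bij_betw (g \<circ> f) (pverts G) (pverts G'')" using f(1) g(1) by (rule bij_betw_trans)
  then show ?thesis unfolding xyz isomorphic.simps
    using f(2,3) g(2,3) fV by (intro exI[of _ "g \<circ> f"]) auto
qed

context
  \<comment> \<open>An isomorphism constrains the arcs between vertices only, so both arc sets are required to
      contain no others; otherwise \<open>neighbors\<close> would not be transported.\<close>
  fixes G :: "'v pair_pre_digraph" and G' :: "'w pair_pre_digraph" and f :: "'v \<Rightarrow> 'w"
  assumes bij: "bij_betw f (pverts G) (pverts G')"
    and arc: "\<forall>v\<in>pverts G. \<forall>w\<in>pverts G. (v, w) \<in> parcs G \<longleftrightarrow> (f v, f w) \<in> parcs G'"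
    and wf: "parcs G \<subseteq> pverts G \<times> pverts G" and wf': "parcs G' \<subseteq> pverts G' \<times> pverts G'"
begin

lemma neighbors_bij_image:
  assumes "v \<in> pverts G"
  shows "neighbors G' (f v) = f ` neighbors G v"
proof (intro set_eqI iffI)
  fix w' assume "w' \<in> neighbors G' (f v)"
  then have w': "(f v, w') \<in> parcs G'" by (simp add: neighbors_def)
  then obtain w where "w \<in> pverts G" "w' = f w"
    using wf' bij by (auto simp: bij_betw_def)
  then show "w' \<in> f ` neighbors G v" using arc assms w' by (auto simp: neighbors_def)
next
  fix w' assume "w' \<in> f ` neighbors G v"
  then show "w' \<in> neighbors G' (f v)" using arc assms wf by (auto simp: neighbors_def)
qed

lemma neighbors_inj_on: "inj_on f (neighbors G v)"
proof -
  have "neighbors G v \<subseteq> pverts G" using wf by (auto simp: neighbors_def)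
  then show ?thesis using bij by (auto simp: bij_betw_def intro: inj_on_subset)
qed

lemma card_neighbors_bij: "v \<in> pverts G \<Longrightarrow> card (neighbors G' (f v)) = card (neighbors G v)"
  by (simp add: neighbors_bij_image card_image neighbors_inj_on)

lemma pverts_bij_image: "pverts G' = f ` pverts G"
  using bij by (auto simp: bij_betw_def)

lemma nonleaves_bij_image: "pverts G' - leaves G' = f ` (pverts G - leaves G)"
  using card_neighbors_bij by (auto simp: in_leaves_iff pverts_bij_image)

lemma collection_of_bij:
  assumes lab: "\<forall>v\<in>pverts G. l' (f v) = l v"
  shows "collection_of (G', l') = collection_of (G, l)"
proof -
  have "l' ` closed_neighborhood G' (f v) = l ` closed_neighborhood G v"
    if "v \<in> pverts G - leaves G" for v
  proof -
    have "closed_neighborhood G v \<subseteq> pverts G" using that wf by (auto simp: neighbors_def)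
    moreover have "closed_neighborhood G' (f v) = f ` closed_neighborhood G v"
      using neighbors_bij_image that by auto
    moreover have "l' ` f ` B = l ` B" if "B \<subseteq> pverts G" for B
      using lab that by (auto simp: image_image intro!: image_cong)
    ultimately show ?thesis by metis
  qed
  then show ?thesis
    unfolding collection_of.simps nonleaves_bij_image by blast
qed

lemma admissible_graph_bij:
  assumes adm: "admissible_graph G"
  shows "admissible_graph G'"
proof -
  have "sym (parcs G')"
  proof (rule symI)
    fix a b assume ab: "(a, b) \<in> parcs G'"
    then obtain v w where "a = f v" "b = f w" "v \<in> pverts G" "w \<in> pverts G"
      using wf' pverts_bij_image by auto
    moreover have "(v, w) \<in> parcs G" using calculation ab arc by blast
    moreover have "sym (parcs G)" using adm by (simp add: admissible_graph_iff)
    ultimately show "(b, a) \<in> parcs G'" using arc by (blast dest: symD)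
  qed
  moreover have "irrefl (parcs G')"
  proof -
    have "(v, v) \<notin> parcs G" for v using adm by (simp add: admissible_graph_iff irrefl_def)
    then have "(f v, f v) \<notin> parcs G'" if "v \<in> pverts G" for v using arc that by blast
    then show ?thesis using wf' unfolding irrefl_def pverts_bij_image by blast
  qed
  moreover have "S = pverts G'"
    if S: "S \<subseteq> pverts G'" "S \<noteq> {}" "\<forall>v\<in>S. neighbors G' v \<subseteq> S" for S
  proof -
    let ?T = "{v \<in> pverts G. f v \<in> S}"
    have "?T \<noteq> {}" using S by (auto simp: pverts_bij_image)
    moreover have "\<forall>v\<in>?T. neighbors G v \<subseteq> ?T"
      using S(3) wf neighbors_bij_image by (fastforce simp: neighbors_def)
    ultimately have "?T = pverts G" using adm by (simp add: admissible_graph_iff)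
    then show ?thesis using S(1) by (auto simp: pverts_bij_image)
  qed
  moreover have "bdd_above ((\<lambda>v. card (neighbors G' v)) ` pverts G')"
    using adm card_neighbors_bij
    by (simp add: admissible_graph_iff pverts_bij_image image_image cong: image_cong)
  moreover have "finite (pverts G') \<longrightarrow> 3 \<le> card (pverts G')"
    using adm bij bij_betw_finite bij_betw_same_card by (metis admissible_graph_iff)
  moreover have "\<forall>v\<in>pverts G'. finite (neighbors G' v)"
    using adm by (simp add: pverts_bij_image neighbors_bij_image admissible_graph_iff)
  moreover have "pverts G' \<noteq> {}" using adm by (simp add: pverts_bij_image admissible_graph_iff)
  ultimately show ?thesis using wf' unfolding admissible_graph_iff by blast
qed

lemma weak_harmonic_labeling_bij:
  assumes harm: "weak_harmonic_labeling G l I"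
    and lab: "\<forall>v\<in>pverts G. l' (f v) = l v"
  shows "weak_harmonic_labeling G' l' I"
proof -
  have sums: "(\<Sum>w\<in>neighbors G' (f v). rat_of_int (l' w)) = (\<Sum>w\<in>neighbors G v. rat_of_int (l w))"
    if "v \<in> pverts G" for v
  proof -
    have "neighbors G v \<subseteq> pverts G" using wf by (auto simp: neighbors_def)
    then show ?thesis
      using lab by (auto simp: neighbors_bij_image[OF that] sum.reindex[OF neighbors_inj_on]
          intro!: sum.cong)
  qed
  have "bij_betw l (pverts G) I \<longleftrightarrow> bij_betw (l' \<circ> f) (pverts G) I"
    using lab by (intro bij_betw_cong) auto
  then have "bij_betw l' (pverts G') I"
    using harm bij_betw_comp_iff[OF bij, of l' I] by (simp add: weak_harmonic_labeling_def)
  then show ?thesis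
    using harm lab sums card_neighbors_bij
    by (auto simp: weak_harmonic_labeling_def nonleaves_bij_image degree_eq_card_neighbors)
qed

end

lemma weakly_labeled_graph_arcs:
  "(G, l) \<in> weakly_labeled_graphs \<Longrightarrow> parcs G \<subseteq> pverts G \<times> pverts G"
  by (simp add: weakly_labeled_graphs_def admissible_graph_iff)

lemma collection_of_isomorphic:
  assumes "x \<in> weakly_labeled_graphs" "y \<in> weakly_labeled_graphs" "isomorphic x y"
  shows "collection_of x = collection_of y"
proof -
  obtain G l G' l' where xy: "x = (G, l)" "y = (G', l')" by fastforce
  then obtain f where "bij_betw f (pverts G) (pverts G')"
    "\<forall>v\<in>pverts G. \<forall>w\<in>pverts G. (v, w) \<in> parcs G \<longleftrightarrow> (f v, f w) \<in> parcs G'"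
    "\<forall>v\<in>pverts G. l' (f v) = l v"
    using assms(3) by auto
  then show ?thesis
    using collection_of_bij[of f G G' l' l] assms(1,2) xy weakly_labeled_graph_arcs by metis
qed

text \<open>
  The graph \<open>G\<^sub>\<A>\<close> has integer vertices; renaming them injectively realizes it on other types.
\<close>

lemma exists_isomorphic_copy:
  fixes x :: "'u labeled_graph" and f :: "'u \<Rightarrow> 'v"
  assumes x: "x \<in> weakly_labeled_graphs" and inj: "inj f"
  shows "\<exists>y \<in> (weakly_labeled_graphs :: 'v labeled_graph set). isomorphic x y"
proof -
  obtain G l where [simp]: "x = (G, l)" by fastforce
  let ?G = "\<lparr>pverts = f ` pverts G, parcs = map_prod f f ` parcs G\<rparr>" and ?l = "l \<circ> inv f"
  have wf: "parcs G \<subseteq> pverts G \<times> pverts G" using x by (simp add: weakly_labeled_graph_arcs)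
  then have wf': "parcs ?G \<subseteq> pverts ?G \<times> pverts ?G" by auto
  have bij: "bij_betw f (pverts G) (pverts ?G)"
    using inj by (auto simp: bij_betw_def intro: inj_on_subset)
  have arc: "\<forall>v\<in>pverts G. \<forall>w\<in>pverts G. (v, w) \<in> parcs G \<longleftrightarrow> (f v, f w) \<in> parcs ?G"
    using inj by (auto dest: injD)
  have lab: "\<forall>v\<in>pverts G. ?l (f v) = l v" using inj by simp
  obtain I where "admissible_graph G" "integer_interval I" "weak_harmonic_labeling G l I"
    using x by (auto simp: weakly_labeled_graphs_def)
  then have "admissible_graph ?G" "weak_harmonic_labeling ?G ?l I"
    using admissible_graph_bij[OF bij arc wf wf']
      weak_harmonic_labeling_bij[OF bij arc wf wf' _ lab] by blast+
  then have "(?G, ?l) \<in> weakly_labeled_graphs"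
    using \<open>integer_interval I\<close> unfolding weakly_labeled_graphs_def by blast
  moreover have "isomorphic x (?G, ?l)" using bij arc lab by auto
  ultimately show ?thesis by blast
qed

section \<open>From graphs to collections\<close>

context
  fixes G :: "'v pair_pre_digraph" and l :: "'v \<Rightarrow> int"
  assumes G: "(G, l) \<in> weakly_labeled_graphs"
begin

lemma admissible: "admissible_graph G"
  using G by (simp add: weakly_labeled_graphs_def)

lemma
  shows finite_neighbors: "v \<in> pverts G \<Longrightarrow> finite (neighbors G v)"
    and neighbors_subset: "neighbors G v \<subseteq> pverts G"
    and neighbors_sym: "w \<in> neighbors G v \<Longrightarrow> v \<in> neighbors G w"
    and not_in_neighbors: "v \<notin> neighbors G v"
    and closed_set_eq: "S \<subseteq> pverts G \<Longrightarrow> S \<noteq> {} \<Longrightarrow> (\<And>v. v \<in> S \<Longrightarrow> neighbors G v \<subseteq> S) \<Longrightarrow> S = pverts G"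
  using admissible by (auto simp: admissible_graph_iff neighbors_def irrefl_def dest: symD)

lemma labeling_inj_on: "inj_on l (pverts G)"
  using G by (auto simp: weakly_labeled_graphs_def weak_harmonic_labeling_def bij_betw_def)

lemma labels_integer_interval: "integer_interval (l ` pverts G)"
  using G by (auto simp: weakly_labeled_graphs_def weak_harmonic_labeling_def bij_betw_def)

text \<open>
  A closed set with one or two vertices would be the whole graph, which has at least three.
\<close>

lemma not_closed_if_small:
  assumes "u \<in> pverts G" "v \<in> pverts G"
  shows "\<exists>x\<in>{u, v}. \<not> neighbors G x \<subseteq> {u, v}"
proof (rule ccontr)
  assume "\<not> ?thesis"
  then have "{u, v} = pverts G" using assms by (intro closed_set_eq) auto
  moreover have "finite (pverts G) \<longrightarrow> 3 \<le> card (pverts G)"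
    using admissible unfolding admissible_graph_iff by (elim conjE)
  ultimately have "3 \<le> card {u, v}" by (metis finite.simps)
  then show False by (simp add: card_insert_if split: if_splits)
qed

lemma neighbors_nonempty: "v \<in> pverts G \<Longrightarrow> neighbors G v \<noteq> {}"
  using not_closed_if_small[of v v] by auto

text \<open>
  The neighbor of a leaf is not a leaf itself, since two adjacent leaves would form a closed set.
\<close>

lemma leaf_neighborsE:
  assumes "v \<in> leaves G"
  obtains w where "neighbors G v = {w}" "w \<in> pverts G - leaves G"
proof -
  obtain w where w: "neighbors G v = {w}"
    using assms card_1_singletonE by (auto simp: in_leaves_iff)
  have v: "v \<in> pverts G" using assms by (simp add: in_leaves_iff)
  have wG: "w \<in> pverts G" using w neighbors_subset[of v] by auto
  have "v \<in> neighbors G w" using w neighbors_sym[of w v] by simp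
  then have "w \<notin> leaves G"
    using not_closed_if_small[OF v wG] w by (auto simp: in_leaves_iff card_1_singleton_iff)
  then show ?thesis using that w wG by auto
qed

abbreviation label_set :: "'v \<Rightarrow> int set" where
  "label_set v \<equiv> l ` closed_neighborhood G v"

lemma in_label_set_iff:
  assumes "v \<in> pverts G" "w \<in> pverts G"
  shows "l w \<in> label_set v \<longleftrightarrow> w = v \<or> w \<in> neighbors G v"
  using labeling_inj_on neighbors_subset[of v] assms
  by (auto dest: inj_onD)

lemma av_label_set:
  assumes v: "v \<in> pverts G - leaves G"
  shows "av (label_set v) = rat_of_int (l v)"
proof -
  let ?N = "neighbors G v"
  have inj: "inj_on l ?N" using labeling_inj_on neighbors_subset by (rule inj_on_subset)
  have "l v \<notin> l ` ?N"
    using labeling_inj_on neighbors_subset[of v] not_in_neighbors v by (auto dest: inj_onD)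
  moreover have "rat_of_int (l v) = (\<Sum>w\<in>?N. rat_of_int (l w)) / rat_of_nat (card ?N)"
    using G v by (auto simp: weakly_labeled_graphs_def weak_harmonic_labeling_def
        degree_eq_card_neighbors)
  ultimately show ?thesis
    using av_insert_eq_iff[of "l ` ?N" "l v"] finite_neighbors neighbors_nonempty v
    by (simp add: sum.reindex[OF inj] card_image[OF inj])
qed

lemma card_label_set:
  assumes "v \<in> pverts G"
  shows "card (label_set v) = Suc (card (neighbors G v))"
proof -
  have "closed_neighborhood G v \<subseteq> pverts G" using neighbors_subset assms by auto
  then have "card (label_set v) = card (closed_neighborhood G v)"
    using labeling_inj_on by (intro card_image) (rule inj_on_subset)
  then show ?thesis using not_in_neighbors finite_neighbors assms by simp
qed

text \<open>
  A leaf is not the centre of a set, but its label occurs in the set of its neighbor.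
\<close>

lemma Union_collection_of: "\<Union> (collection_of (G, l)) = l ` pverts G"
proof
  show "\<Union> (collection_of (G, l)) \<subseteq> l ` pverts G" using neighbors_subset by auto
  have "l v \<in> \<Union> (collection_of (G, l))" if v: "v \<in> pverts G" for v
  proof (cases "v \<in> leaves G")
    case False
    then show ?thesis using v by auto
  next
    case True
    then obtain w where "neighbors G v = {w}" and w: "w \<in> pverts G - leaves G"
      by (rule leaf_neighborsE)
    then have "v \<in> neighbors G w" using neighbors_sym by auto
    then show ?thesis using w by auto
  qed
  then show "l ` pverts G \<subseteq> \<Union> (collection_of (G, l))" by auto
qed

text \<open>
  Non-leaves are joined by paths of non-leaves: the non-leaves reached from \<open>v\<close> in this way, together
  with the leaves attached to them, form a closed set, because a leaf has no neighbor besides the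
  non-leaf it is attached to.
\<close>

lemma nonleaves_connected:
  assumes v: "v \<in> pverts G - leaves G" and w: "w \<in> pverts G - leaves G"
  shows "(v, w) \<in> (Restr (parcs G) (pverts G - leaves G))\<^sup>*"
proof -
  let ?R = "Restr (parcs G) (pverts G - leaves G)"
  let ?N = "{x \<in> pverts G - leaves G. (v, x) \<in> ?R\<^sup>*}"
  let ?S = "?N \<union> {y \<in> leaves G. neighbors G y \<subseteq> ?N}"
  have "?S = pverts G"
  proof (rule closed_set_eq)
    show "?S \<subseteq> pverts G" by (auto simp: in_leaves_iff)
    show "?S \<noteq> {}" using v by auto
  next
    fix x assume "x \<in> ?S"
    then consider "x \<in> ?N" | "neighbors G x \<subseteq> ?N" by auto
    then show "neighbors G x \<subseteq> ?S"
    proof cases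
      case 1
      have "y \<in> ?S" if y: "y \<in> neighbors G x" for y
      proof (cases "y \<in> leaves G")
        case True
        then obtain z where "neighbors G y = {z}" by (rule leaf_neighborsE)
        moreover have "x \<in> neighbors G y" using y by (rule neighbors_sym)
        ultimately show ?thesis using True 1 by auto
      next
        case False
        moreover have "y \<in> pverts G" using y neighbors_subset by auto
        ultimately have "(x, y) \<in> ?R" using y 1 by (auto simp: neighbors_def)
        then have "(v, y) \<in> ?R\<^sup>*" using 1 by (auto intro: rtrancl_into_rtrancl)
        then show ?thesis using False \<open>y \<in> pverts G\<close> by auto
      qed
      then show ?thesis by auto
    qed auto
  qed
  then show ?thesis using w by auto
qed

text \<open>
  Since the centre of \<open>A\<^sub>v\<close> is \<open>\<ell>(v)\<close>, the conditions translate into graph terms: (P2) is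
  injectivity of the labeling, (P3) says that a vertex with two neighbors is not a leaf, (P4) is
  the symmetry of adjacency, and (P5) is the connectedness of the non-leaves.
\<close>

lemma collection_of_in_harmonic_collections: "collection_of (G, l) \<in> harmonic_collections"
proof -
  let ?A = "collection_of (G, l)" and ?V = "pverts G - leaves G"
  have mem: "X \<in> ?A \<longleftrightarrow> (\<exists>v\<in>?V. X = label_set v)" for X by auto
  have harmonic: "harmonic_subset (label_set v)" if "v \<in> ?V" for v
    using that av_label_set finite_neighbors by (auto simp: harmonic_subset_def)
  have nontrivial: "card (label_set v) \<noteq> 1" if "v \<in> ?V" for v
    using that card_label_set[of v] finite_neighbors[of v] neighbors_nonempty[of v] by auto
  have in_iff: "av (label_set v) \<in> rat_of_int ` label_set w \<longleftrightarrow> v = w \<or> v \<in> neighbors G w"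
    if "v \<in> ?V" "w \<in> ?V" for v w
    using that in_label_set_iff[of w v] by (auto simp: av_label_set simp del: image_insert)
  have bounded: "bdd_above (card ` ?A)"
  proof -
    have "bdd_above ((\<lambda>v. card (neighbors G v)) ` pverts G)"
      using admissible by (simp only: admissible_graph_iff)
    then obtain K where K: "\<And>v. v \<in> pverts G \<Longrightarrow> card (neighbors G v) \<le> K"
      by (auto simp: bdd_above_def)
    have "card X \<le> Suc K" if X: "X \<in> ?A" for X
    proof -
      obtain v where "v \<in> ?V" "X = label_set v" using X mem by blast
      then show ?thesis using K card_label_set by simp
    qed
    then show ?thesis by (rule bdd_aboveI2)
  qed
  have P3: "\<exists>u\<in>?V. l u = t" if "v \<in> ?V" "w \<in> ?V" "v \<noteq> w" "t \<in> label_set v \<inter> label_set w" for v w t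
  proof -
    have "t \<in> l ` pverts G" using that neighbors_subset[of v] by auto
    then obtain u where u: "u \<in> pverts G" "t = l u" by auto
    then have near: "u = v \<or> u \<in> neighbors G v" "u = w \<or> u \<in> neighbors G w"
      using that in_label_set_iff[of v u] in_label_set_iff[of w u] by auto
    have "u \<notin> leaves G"
    proof
      \<comment> \<open>A leaf differs from both \<open>v\<close> and \<open>w\<close>, so it would be adjacent to both.\<close>
      assume leaf: "u \<in> leaves G"
      then have "v \<in> neighbors G u" "w \<in> neighbors G u"
        using near that neighbors_sym by auto
      moreover obtain z where "neighbors G u = {z}" using leaf by (rule leaf_neighborsE)
      ultimately show False using that by auto
    qed
    then show ?thesis using u by auto
  qed
  have P5: "(label_set v, label_set w) \<in>
      {(X, Y). X \<in> ?A \<and> Y \<in> ?A \<and> av X \<in> rat_of_int ` Y}\<^sup>*" (is "_ \<in> ?R\<^sup>*")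
    if "v \<in> ?V" "w \<in> ?V" for v w
    using nonleaves_connected[OF that]
  proof (induction rule: rtrancl_induct)
    case (step y z)
    then have "y \<in> ?V" "z \<in> ?V" "y \<in> neighbors G z"
      using neighbors_sym by (auto simp: neighbors_def)
    then have "(label_set y, label_set z) \<in> ?R" using in_iff mem by blast
    then show ?case using step.IH by (rule rtrancl_into_rtrancl[rotated])
  qed auto
  show ?thesis unfolding harmonic_collections_def mem_Collect_eq linked_iff_rtrancl
  proof (intro conjI ballI allI impI)
    fix X assume "X \<in> ?A"
    then obtain v where "v \<in> ?V" "X = label_set v" using mem by blast
    then show "harmonic_subset X" "card X \<noteq> 1" using harmonic nontrivial by auto
  next
    show "bdd_above (card ` ?A)" by (rule bounded)
    show "integer_interval (\<Union>?A)"
      using labels_integer_interval by (simp only: Union_collection_of)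
  next
    fix X Y assume XY: "X \<in> ?A" "Y \<in> ?A" "X \<noteq> Y"
    obtain v where v: "v \<in> ?V" "X = label_set v" using XY(1) mem by blast
    obtain w where w: "w \<in> ?V" "Y = label_set w" using XY(2) mem by blast
    note vw = v w
    have "v \<noteq> w" using XY(3) vw by blast
    then have "l v \<noteq> l w" using labeling_inj_on vw by (auto dest: inj_onD)
    then show "av X \<noteq> av Y" using vw by (simp add: av_label_set del: image_insert)
  next
    fix X Y t assume XY: "X \<in> ?A" "Y \<in> ?A" and t: "t \<in> X \<inter> Y \<and> X \<noteq> Y"
    obtain v where v: "v \<in> ?V" "X = label_set v" using XY(1) mem by blast
    obtain w where w: "w \<in> ?V" "Y = label_set w" using XY(2) mem by blast
    note vw = v w
    have "v \<noteq> w" using t vw by blast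
    then obtain u where "u \<in> ?V" "l u = t" using P3 t vw by blast
    then show "\<exists>Z\<in>?A. av Z = rat_of_int t" using av_label_set mem by blast
  next
    fix X Y assume XY: "X \<in> ?A" "Y \<in> ?A" "av X \<in> rat_of_int ` Y"
    obtain v where v: "v \<in> ?V" "X = label_set v" using XY(1) mem by blast
    obtain w where w: "w \<in> ?V" "Y = label_set w" using XY(2) mem by blast
    have "v = w \<or> v \<in> neighbors G w" using XY(3) in_iff[OF v(1) w(1)] by (simp only: v(2) w(2))
    then have "w = v \<or> w \<in> neighbors G v" using neighbors_sym by auto
    then show "av Y \<in> rat_of_int ` X" using in_iff[OF w(1) v(1)] by (simp only: v(2) w(2))
  next
    fix X Y assume XY: "X \<in> ?A" "Y \<in> ?A"
    obtain v where v: "v \<in> ?V" "X = label_set v" using XY(1) mem by blast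
    obtain w where w: "w \<in> ?V" "Y = label_set w" using XY(2) mem by blast
    show "(X, Y) \<in> ?R\<^sup>*" unfolding v(2) w(2) using v(1) w(1) by (rule P5)
    show "X \<in> ?A" by (rule XY)
  qed
qed

text \<open>
  The labeling itself is the isomorphism. An edge survives because one of its ends is not a leaf,
  and that end is the centre of a set containing the label of the other.
\<close>

lemma isomorphic_graph_of_collection:
  "isomorphic (G, l) (labeled_graph_of (collection_of (G, l)))"
proof -
  let ?A = "collection_of (G, l)" and ?V = "pverts G - leaves G"
  let ?centred = "\<lambda>v w. \<exists>X\<in>?A. rat_of_int (l v) = av X \<and> l w \<in> X"
  have centred: "?centred v w \<longleftrightarrow> v \<in> ?V \<and> (w = v \<or> w \<in> neighbors G v)"
    if "v \<in> pverts G" "w \<in> pverts G" for v w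
  proof
    assume "?centred v w"
    then obtain u where u: "u \<in> ?V" "rat_of_int (l v) = av (label_set u)" "l w \<in> label_set u"
      by auto
    then have "l v = l u" by (simp add: av_label_set del: image_insert)
    then have "v = u" using labeling_inj_on that u by (auto dest: inj_onD)
    then show "v \<in> ?V \<and> (w = v \<or> w \<in> neighbors G v)"
      using u that in_label_set_iff[of v w] by auto
  next
    assume *: "v \<in> ?V \<and> (w = v \<or> w \<in> neighbors G v)"
    then have "label_set v \<in> ?A" "l w \<in> label_set v" by auto
    then show "?centred v w" using av_label_set * by metis
  qed
  have "(v, w) \<in> parcs G \<longleftrightarrow> (l v, l w) \<in> parcs (graph_of ?A)"
    if vw: "v \<in> pverts G" "w \<in> pverts G" for v w
  proof -
    have "(l v, l w) \<in> parcs (graph_of ?A) \<longleftrightarrow> l v \<noteq> l w \<and> (?centred v w \<or> ?centred w v)"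
      using vw unfolding graph_of_def Union_collection_of by auto
    also have "\<dots> \<longleftrightarrow> v \<noteq> w \<and> (v \<in> ?V \<and> w \<in> neighbors G v \<or> w \<in> ?V \<and> v \<in> neighbors G w)"
      using vw centred labeling_inj_on by (auto dest: inj_onD)
    also have "\<dots> \<longleftrightarrow> w \<in> neighbors G v"
    proof
      assume w: "w \<in> neighbors G v"
      have "w \<in> ?V" if "v \<in> leaves G"
        using leaf_neighborsE[OF that] w by (metis singletonD)
      then show "v \<noteq> w \<and> (v \<in> ?V \<and> w \<in> neighbors G v \<or> w \<in> ?V \<and> v \<in> neighbors G w)"
        using w neighbors_sym[OF w] not_in_neighbors[of v] vw by auto
    qed (use neighbors_sym in auto)
    finally show ?thesis by (simp add: neighbors_def)
  qed
  moreover have "bij_betw l (pverts G) (pverts (graph_of ?A))"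
    using labeling_inj_on Union_collection_of by (simp add: bij_betw_def graph_of_def)
  ultimately show ?thesis
    unfolding labeled_graph_of_def isomorphic.simps by blast
qed

end

section \<open>From collections to graphs\<close>

context
  fixes \<A> :: "int set set"
  assumes \<A>: "\<A> \<in> harmonic_collections"
begin

lemma
  shows member_harmonic: "A \<in> \<A> \<Longrightarrow> harmonic_subset A"
    and member_nontrivial: "A \<in> \<A> \<Longrightarrow> card A \<noteq> 1"
    and bdd_above_card: "bdd_above (card ` \<A>)"
    and integer_interval_Union: "integer_interval (\<Union>\<A>)"
    and centre_unique: "A \<in> \<A> \<Longrightarrow> B \<in> \<A> \<Longrightarrow> av A = av B \<Longrightarrow> A = B"
    and shared_is_centre:
      "A \<in> \<A> \<Longrightarrow> B \<in> \<A> \<Longrightarrow> t \<in> A \<Longrightarrow> t \<in> B \<Longrightarrow> A \<noteq> B \<Longrightarrow> \<exists>C\<in>\<A>. av C = rat_of_int t"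
    and centre_swap:
      "A \<in> \<A> \<Longrightarrow> B \<in> \<A> \<Longrightarrow> av A \<in> rat_of_int ` B \<Longrightarrow> av B \<in> rat_of_int ` A"
    and members_linked:
      "A \<in> \<A> \<Longrightarrow> B \<in> \<A> \<Longrightarrow> (A, B) \<in> {(X, Y). X \<in> \<A> \<and> Y \<in> \<A> \<and> av X \<in> rat_of_int ` Y}\<^sup>*"
proof -
  let ?R = "{(X, Y). X \<in> \<A> \<and> Y \<in> \<A> \<and> av X \<in> rat_of_int ` Y}"
  have *: "\<forall>A\<in>\<A>. harmonic_subset A \<and> card A \<noteq> 1"
    "bdd_above (card ` \<A>)" "integer_interval (\<Union>\<A>)"
    "\<forall>A\<in>\<A>. \<forall>B\<in>\<A>. A \<noteq> B \<longrightarrow> av A \<noteq> av B"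
    "\<forall>A\<in>\<A>. \<forall>B\<in>\<A>. \<forall>t. t \<in> A \<inter> B \<and> A \<noteq> B \<longrightarrow> (\<exists>C\<in>\<A>. av C = rat_of_int t)"
    "\<forall>A\<in>\<A>. \<forall>B\<in>\<A>. av A \<in> rat_of_int ` B \<longrightarrow> av B \<in> rat_of_int ` A"
    "\<forall>A\<in>\<A>. \<forall>B\<in>\<A>. A \<in> \<A> \<and> (A, B) \<in> ?R\<^sup>*"
    using \<A> unfolding harmonic_collections_def mem_Collect_eq linked_iff_rtrancl
    by - (elim conjE, assumption)+
  show "A \<in> \<A> \<Longrightarrow> harmonic_subset A" "A \<in> \<A> \<Longrightarrow> card A \<noteq> 1" using *(1) by auto
  show "bdd_above (card ` \<A>)" "integer_interval (\<Union>\<A>)" by (fact *)+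
  show "A \<in> \<A> \<Longrightarrow> B \<in> \<A> \<Longrightarrow> av A = av B \<Longrightarrow> A = B" using *(4) by blast
  show "A \<in> \<A> \<Longrightarrow> B \<in> \<A> \<Longrightarrow> t \<in> A \<Longrightarrow> t \<in> B \<Longrightarrow> A \<noteq> B \<Longrightarrow> \<exists>C\<in>\<A>. av C = rat_of_int t"
    using *(5) by blast
  show "A \<in> \<A> \<Longrightarrow> B \<in> \<A> \<Longrightarrow> av A \<in> rat_of_int ` B \<Longrightarrow> av B \<in> rat_of_int ` A"
    using *(6) by blast
  show "A \<in> \<A> \<Longrightarrow> B \<in> \<A> \<Longrightarrow> (A, B) \<in> ?R\<^sup>*" using *(7) by blast
qed

lemma centreE:
  assumes "A \<in> \<A>"
  obtains i where "i \<in> A" "av A = rat_of_int i"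
  using member_harmonic[OF assms] by (auto simp: harmonic_subset_def)

lemma member_finite: "A \<in> \<A> \<Longrightarrow> finite A"
  using member_harmonic by (simp add: harmonic_subset_def)

lemma member_card: "A \<in> \<A> \<Longrightarrow> 3 \<le> card A"
  using member_harmonic member_nontrivial harmonic_subset_card_ge_3 by blast

lemma pverts_graph_of: "pverts (graph_of \<A>) = \<Union>\<A>"
  by (simp add: graph_of_def)

text \<open>
  The centre of \<open>A\<close> belongs to \<open>A\<close>, so an edge always lies inside a member of \<open>\<A>\<close>, which makes
  the description of adjacency symmetric in its two ends.
\<close>

lemma in_neighbors_graph_of_iff:
  "j \<in> neighbors (graph_of \<A>) i \<longleftrightarrow>
     i \<noteq> j \<and> (\<exists>A\<in>\<A>. (av A = rat_of_int i \<or> av A = rat_of_int j) \<and> i \<in> A \<and> j \<in> A)"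
  (is "?L \<longleftrightarrow> ?R")
proof
  have "k \<in> A" if "A \<in> \<A>" "rat_of_int k = av A" for A k
    using that centreE[of A] by (metis of_int_eq_iff)
  then show "?L \<Longrightarrow> ?R" unfolding neighbors_def graph_of_def by (auto; metis)
  show "?R \<Longrightarrow> ?L" unfolding neighbors_def graph_of_def by (auto; metis)
qed

text \<open>
  If \<open>i\<close> is adjacent to \<open>j\<close> because it lies in a set \<open>B\<close> centred at \<open>j\<close>, the symmetry condition (P4)
  shows that \<open>j\<close> lies in the set \<open>A\<close> centred at \<open>i\<close>, so that no neighbors arise outside \<open>A\<close>.
\<close>

lemma neighbors_centre:
  assumes A: "A \<in> \<A>" and i: "av A = rat_of_int i"
  shows "neighbors (graph_of \<A>) i = A - {i}"
proof (intro set_eqI iffI)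
  fix j assume "j \<in> neighbors (graph_of \<A>) i"
  then obtain B where B: "B \<in> \<A>" "i \<noteq> j" "i \<in> B" "j \<in> B"
    and "av B = rat_of_int i \<or> av B = rat_of_int j"
    unfolding in_neighbors_graph_of_iff by auto
  then consider "av B = rat_of_int i" | "av B = rat_of_int j" by auto
  then show "j \<in> A - {i}"
  proof cases
    case 1
    then have "A = B" using centre_unique A B i by simp
    then show ?thesis using B by auto
  next
    case 2
    have "av A \<in> rat_of_int ` B" using B i by simp
    then have "av B \<in> rat_of_int ` A" by (rule centre_swap[OF A B(1)])
    then show ?thesis using 2 B(2) by (auto simp: image_iff)
  qed
next
  fix j assume "j \<in> A - {i}"
  moreover have "i \<in> A" using centreE[OF A] i by (metis of_int_eq_iff)
  ultimately show "j \<in> neighbors (graph_of \<A>) i"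
    using A i by (auto simp: in_neighbors_graph_of_iff)
qed

text \<open>
  By (P3), \<open>A\<close> is the only member containing \<open>i\<close>, because points shared by two members are centres.
\<close>

lemma neighbors_noncentre:
  assumes A: "A \<in> \<A>" "i \<in> A" and c: "c \<in> A" "av A = rat_of_int c"
    and i: "\<forall>B\<in>\<A>. av B \<noteq> rat_of_int i"
  shows "neighbors (graph_of \<A>) i = {c}"
proof (intro set_eqI iffI)
  fix j assume "j \<in> neighbors (graph_of \<A>) i"
  then obtain B where B: "B \<in> \<A>" "i \<in> B" "av B = rat_of_int j"
    using i unfolding in_neighbors_graph_of_iff by auto
  then have "A = B" using shared_is_centre A i by blast
  then show "j \<in> {c}" using c B by auto
next
  fix j assume "j \<in> {c}"
  moreover have "i \<noteq> c" using i A c by auto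
  ultimately show "j \<in> neighbors (graph_of \<A>) i"
    using A c by (auto simp: in_neighbors_graph_of_iff)
qed

lemma closed_neighborhood_centre:
  assumes A: "A \<in> \<A>" and i: "av A = rat_of_int i"
  shows "closed_neighborhood (graph_of \<A>) i = A"
proof -
  have "i \<in> A" using centreE[OF A] i by (metis of_int_eq_iff)
  then show ?thesis using neighbors_centre[OF A i] by auto
qed

lemma card_neighbors_centre:
  assumes A: "A \<in> \<A>" and i: "av A = rat_of_int i"
  shows "card A = Suc (card (neighbors (graph_of \<A>) i))"
proof -
  have "i \<in> A" using centreE[OF A] i by (metis of_int_eq_iff)
  then show ?thesis unfolding neighbors_centre[OF A i] by (rule card.remove[OF member_finite[OF A]])
qed

lemma nonleaves_graph_of:
  "pverts (graph_of \<A>) - leaves (graph_of \<A>) = {i. \<exists>A\<in>\<A>. av A = rat_of_int i}"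
proof (intro set_eqI iffI)
  fix i assume i: "i \<in> pverts (graph_of \<A>) - leaves (graph_of \<A>)"
  then obtain A where A: "A \<in> \<A>" "i \<in> A" by (auto simp: pverts_graph_of)
  obtain c where "c \<in> A" "av A = rat_of_int c" using A(1) by (rule centreE)
  then have "card (neighbors (graph_of \<A>) i) = 1" if "\<forall>B\<in>\<A>. av B \<noteq> rat_of_int i"
    using neighbors_noncentre[OF A _ _ that, of c] by simp
  moreover have "card (neighbors (graph_of \<A>) i) \<noteq> 1" using i by (simp add: in_leaves_iff)
  ultimately show "i \<in> {i. \<exists>A\<in>\<A>. av A = rat_of_int i}" by blast
next
  fix i assume "i \<in> {i. \<exists>A\<in>\<A>. av A = rat_of_int i}"
  then obtain A where A: "A \<in> \<A>" "av A = rat_of_int i" by auto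
  then have "card (neighbors (graph_of \<A>) i) \<noteq> 1"
    using member_card[of A] card_neighbors_centre[of A i] by linarith
  then show "i \<in> pverts (graph_of \<A>) - leaves (graph_of \<A>)"
    using A closed_neighborhood_centre[OF A] by (auto simp: in_leaves_iff pverts_graph_of)
qed

lemma collection_of_labeled_graph_of: "collection_of (labeled_graph_of \<A>) = \<A>"
proof -
  have "collection_of (labeled_graph_of \<A>) =
      {closed_neighborhood (graph_of \<A>) i | i. \<exists>A\<in>\<A>. av A = rat_of_int i}"
    unfolding labeled_graph_of_def collection_of.simps nonleaves_graph_of by simp
  also have "\<dots> = \<A>"
  proof (intro set_eqI iffI)
    fix A assume A: "A \<in> \<A>"
    then obtain i where "av A = rat_of_int i" by (rule centreE)
    then show "A \<in> {closed_neighborhood (graph_of \<A>) i | i. \<exists>A\<in>\<A>. av A = rat_of_int i}"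
      using A closed_neighborhood_centre[OF A] by blast
  next
    fix A assume "A \<in> {closed_neighborhood (graph_of \<A>) i | i. \<exists>A\<in>\<A>. av A = rat_of_int i}"
    then show "A \<in> \<A>" using closed_neighborhood_centre by auto
  qed
  finally show ?thesis .
qed

text \<open>
  A closed set that meets a member of \<open>\<A>\<close> contains its centre, hence all of it, and then every
  other member by (P5).
\<close>

lemma graph_of_connected:
  assumes S: "S \<subseteq> \<Union>\<A>" "S \<noteq> {}" and closed: "\<And>i. i \<in> S \<Longrightarrow> neighbors (graph_of \<A>) i \<subseteq> S"
  shows "S = \<Union>\<A>"
proof -
  have absorb: "A \<subseteq> S" if A: "A \<in> \<A>" and i: "i \<in> A" "i \<in> S" for A i
  proof -
    obtain c where c: "c \<in> A" "av A = rat_of_int c" using A by (rule centreE)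
    have "c \<in> S"
    proof (cases "c = i")
      case False
      then have "c \<in> neighbors (graph_of \<A>) i"
        using A i c by (auto simp: in_neighbors_graph_of_iff)
      then show ?thesis using closed i by auto
    qed (use i in simp)
    then show ?thesis using closed[of c] neighbors_centre[OF A c(2)] by auto
  qed
  obtain i where "i \<in> S" using S(2) by blast
  moreover obtain A where "A \<in> \<A>" "i \<in> A" using S(1) \<open>i \<in> S\<close> by blast
  ultimately have A: "A \<in> \<A>" "A \<subseteq> S" using absorb by simp_all
  have "B \<subseteq> S" if B: "B \<in> \<A>" for B
    using members_linked[OF A(1) B]
  proof (induction rule: rtrancl_induct)
    case base
    show ?case by (rule A)
  next
    case (step X Y)
    then have X: "X \<in> \<A>" and Y: "Y \<in> \<A>" "av X \<in> rat_of_int ` Y" by auto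
    obtain c where "c \<in> X" "av X = rat_of_int c" using X by (rule centreE)
    moreover have "c \<in> Y" using Y(2) calculation(2) by auto
    ultimately show ?case using absorb[OF Y(1), of c] step.IH by blast
  qed
  then show ?thesis using S by auto
qed

text \<open>
  Transfers the uniform bound on the members of \<open>\<A>\<close> to the degrees.
\<close>

lemma card_neighbors_le_card_member:
  assumes "i \<in> \<Union>\<A>"
  shows "finite (neighbors (graph_of \<A>) i) \<and>
    (\<exists>A\<in>\<A>. card (neighbors (graph_of \<A>) i) \<le> card A)"
proof (cases "\<exists>A\<in>\<A>. av A = rat_of_int i")
  case True
  then obtain A where A: "A \<in> \<A>" "av A = rat_of_int i" by auto
  then show ?thesis
    using neighbors_centre[OF A] card_neighbors_centre[OF A] member_finite by fastforce
next
  case False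
  obtain A where A: "A \<in> \<A>" "i \<in> A" using assms by auto
  obtain c where "c \<in> A" "av A = rat_of_int c" using A(1) by (rule centreE)
  then have "neighbors (graph_of \<A>) i = {c}" using neighbors_noncentre[OF A] False by blast
  then show ?thesis using A(1) member_card[OF A(1)] by (auto intro!: bexI[of _ A])
qed

lemma admissible_graph_of: "admissible_graph (graph_of \<A>)"
proof -
  obtain K where K: "\<And>A. A \<in> \<A> \<Longrightarrow> card A \<le> K"
    using bdd_above_card by (auto simp: bdd_above_def)
  have "card (neighbors (graph_of \<A>) i) \<le> K" if "i \<in> \<Union>\<A>" for i
    using card_neighbors_le_card_member[OF that] K by (meson order_trans)
  then have bounded: "bdd_above ((\<lambda>i. card (neighbors (graph_of \<A>) i)) ` \<Union>\<A>)"
    by (rule bdd_aboveI2)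
  have nonempty: "\<Union>\<A> \<noteq> {}"
    using integer_interval_Union by (simp add: integer_interval_def)
  have "3 \<le> card (\<Union>\<A>)" if fin: "finite (\<Union>\<A>)"
  proof -
    obtain A where A: "A \<in> \<A>" using nonempty by auto
    then have "card A \<le> card (\<Union>\<A>)" using fin by (intro card_mono) auto
    then show ?thesis using member_card[OF A] by simp
  qed
  moreover have "parcs (graph_of \<A>) \<subseteq> \<Union>\<A> \<times> \<Union>\<A>" by (auto simp: graph_of_def)
  moreover have "irrefl (parcs (graph_of \<A>))" by (simp add: graph_of_def irrefl_def)
  moreover have "sym (parcs (graph_of \<A>))" by (rule symI) (auto simp: graph_of_def)
  moreover have "\<forall>i\<in>\<Union>\<A>. finite (neighbors (graph_of \<A>) i)"
    using card_neighbors_le_card_member by blast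
  moreover have "\<forall>S\<subseteq>\<Union>\<A>. S \<noteq> {} \<and> (\<forall>i\<in>S. neighbors (graph_of \<A>) i \<subseteq> S) \<longrightarrow> S = \<Union>\<A>"
    using graph_of_connected by simp
  ultimately show ?thesis
    unfolding admissible_graph_iff pverts_graph_of
    using nonempty bounded by (intro conjI impI) simp_all
qed

lemma labeled_graph_of_weakly_labeled: "labeled_graph_of \<A> \<in> weakly_labeled_graphs"
proof -
  have "rat_of_int i =
      (\<Sum>j\<in>neighbors (graph_of \<A>) i. rat_of_int j) / rat_of_nat (card (neighbors (graph_of \<A>) i))"
    if "i \<in> pverts (graph_of \<A>) - leaves (graph_of \<A>)" for i
  proof -
    obtain A where A: "A \<in> \<A>" "av A = rat_of_int i" using \<open>i \<in> _\<close> nonleaves_graph_of by auto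
    let ?N = "neighbors (graph_of \<A>) i"
    have "insert i ?N = A" using A by (rule closed_neighborhood_centre)
    moreover have "finite ?N" "i \<notin> ?N"
      using neighbors_centre[OF A] member_finite[OF A(1)] by auto
    moreover have "?N \<noteq> {}"
      using card_neighbors_centre[OF A] member_card[OF A(1)] by auto
    ultimately show ?thesis using av_insert_eq_iff[of ?N i] A(2) by simp
  qed
  then have "weak_harmonic_labeling (graph_of \<A>) (\<lambda>i. i) (\<Union>\<A>)"
    by (auto simp: weak_harmonic_labeling_def degree_eq_card_neighbors pverts_graph_of bij_betw_def)
  then show ?thesis
    using admissible_graph_of integer_interval_Union
    by (auto simp: labeled_graph_of_def weakly_labeled_graphs_def)
qed

end

section \<open>The correspondence on isomorphism classes\<close>

lemma iso_rel_iff: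
  "(x, y) \<in> iso_rel \<longleftrightarrow>
     x \<in> weakly_labeled_graphs \<and> y \<in> weakly_labeled_graphs \<and> isomorphic x y"
  by (simp add: iso_rel_def del: isomorphic.simps)

lemma equiv_iso_rel: "equiv weakly_labeled_graphs iso_rel"
proof (rule equivI)
  show "iso_rel \<subseteq> weakly_labeled_graphs \<times> weakly_labeled_graphs"
    by (simp add: subset_iff iso_rel_iff)
  show "refl_on weakly_labeled_graphs iso_rel"
    by (rule refl_onI) (simp add: iso_rel_iff isomorphic_refl)
  show "sym iso_rel"
    by (rule symI) (simp add: iso_rel_iff isomorphic_sym)
  show "trans iso_rel"
    by (rule transI, unfold iso_rel_iff) (blast intro: isomorphic_trans)
qed

lemma iso_rel_Image:
  "x \<in> weakly_labeled_graphs \<Longrightarrow> iso_rel `` {x} = {y \<in> weakly_labeled_graphs. isomorphic x y}"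
  by (simp add: Image_def iso_rel_iff)

lemma to_collection_class:
  assumes x: "x \<in> weakly_labeled_graphs"
  shows "to_collection (iso_rel `` {x}) = collection_of x"
proof -
  have "collection_of ` (iso_rel `` {x}) = {collection_of x}"
    using x isomorphic_refl[of x] collection_of_isomorphic[OF x] unfolding iso_rel_Image[OF x]
    by fastforce
  then show ?thesis by (simp add: to_collection_def)
qed

text \<open>
  The class of \<open>(G\<^sub>\<A>, \<ell>\<^sub>\<A>)\<close> on a type other than the integers is named by any copy \<open>x\<close> there.
\<close>

lemma to_iso_class_eq_class:
  fixes x :: "'v labeled_graph"
  assumes "isomorphic (labeled_graph_of \<A>) x" "x \<in> weakly_labeled_graphs"
  shows "to_iso_class \<A> = iso_rel `` {x}"
proof -
  have "isomorphic (labeled_graph_of \<A>) y \<longleftrightarrow> isomorphic x y" for y :: "'v labeled_graph"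
    using isomorphic_trans[OF assms(1)] isomorphic_trans[OF isomorphic_sym[OF assms(1)]] by blast
  then show ?thesis by (simp add: to_iso_class_def iso_rel_Image[OF assms(2)])
qed

lemma exists_isomorphic_to_labeled_graph_of:
  assumes "\<A> \<in> harmonic_collections" "infinite (UNIV :: 'v set)"
  shows "\<exists>x \<in> (weakly_labeled_graphs :: 'v labeled_graph set). isomorphic (labeled_graph_of \<A>) x"
proof -
  obtain g :: "nat \<Rightarrow> 'v" where "inj g"
    using infinite_countable_subset[OF assms(2)] by auto
  then have "inj (g \<circ> to_nat :: int \<Rightarrow> 'v)" by (intro inj_compose) auto
  then show ?thesis
    using exists_isomorphic_copy labeled_graph_of_weakly_labeled[OF assms(1)] by blast
qed

theorem theorem18:
  assumes "infinite (UNIV :: 'v set)"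
  shows "equiv (weakly_labeled_graphs :: 'v labeled_graph set) iso_rel \<and>
    (collection_of :: 'v labeled_graph \<Rightarrow> int set set) respects iso_rel \<and>
    (\<forall>\<A>\<in>harmonic_collections. labeled_graph_of \<A> \<in> weakly_labeled_graphs) \<and>
    (to_collection :: 'v labeled_graph set \<Rightarrow> int set set)
      \<in> iso_classes \<rightarrow> harmonic_collections \<and>
    (to_iso_class :: int set set \<Rightarrow> 'v labeled_graph set)
      \<in> harmonic_collections \<rightarrow> iso_classes \<and>
    (\<forall>X\<in>(iso_classes :: 'v labeled_graph set set). to_iso_class (to_collection X) = X) \<and>
    (\<forall>\<A>\<in>harmonic_collections.
       to_collection (to_iso_class \<A> :: 'v labeled_graph set) = \<A>)"
proof -
  have classE: "\<exists>x \<in> weakly_labeled_graphs. X = iso_rel `` {x}"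
    if "X \<in> iso_classes" for X :: "'v labeled_graph set"
    using that by (auto simp: iso_classes_def quotient_def)
  have respects: "(collection_of :: 'v labeled_graph \<Rightarrow> int set set) respects iso_rel"
    by (rule congruentI) (metis collection_of_isomorphic iso_rel_iff)
  have to_coll: "to_collection X \<in> harmonic_collections \<and> to_iso_class (to_collection X) = X"
    if X: "X \<in> iso_classes" for X :: "'v labeled_graph set"
  proof -
    obtain x where x: "x \<in> weakly_labeled_graphs" "X = iso_rel `` {x}" using classE[OF X] by blast
    obtain G l where Gl: "x = (G, l)" by fastforce
    have "isomorphic (labeled_graph_of (collection_of x)) x"
      using isomorphic_graph_of_collection x(1) Gl isomorphic_sym by blast
    then show ?thesis
      using to_iso_class_eq_class x to_collection_class collection_of_in_harmonic_collections Gl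
      by metis
  qed
  have to_class: "to_iso_class \<A> \<in> (iso_classes :: 'v labeled_graph set set) \<and>
      to_collection (to_iso_class \<A> :: 'v labeled_graph set) = \<A>"
    if A: "\<A> \<in> harmonic_collections" for \<A>
  proof -
    obtain x :: "'v labeled_graph" where x: "x \<in> weakly_labeled_graphs"
      and iso: "isomorphic (labeled_graph_of \<A>) x"
      using exists_isomorphic_to_labeled_graph_of[OF A assms] by blast
    have "collection_of x = \<A>"
      using collection_of_isomorphic[OF labeled_graph_of_weakly_labeled[OF A] x iso]
        collection_of_labeled_graph_of[OF A] by simp
    then show ?thesis
      using to_iso_class_eq_class[OF iso x] to_collection_class[OF x] x
      by (simp add: iso_classes_def quotientI)
  qed
  show ?thesis
    using equiv_iso_rel respects labeled_graph_of_weakly_labeled to_coll to_class by blast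
qed

end
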